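(* Let $D$ and $L$ be two regular BiHom-associative dialgebras together with an action of $D$ on $L$. Then $\mathbf{Lb}(L\rtimes D)=\mathbf{Lb}(L)\rtimes\mathbf{Lb}(D)$; that is, on the vector space $L\oplus D$ these two structures have the same bracket (and the same structure maps).
   Context: All vector spaces are over a fixed field; structure maps of every object are denoted $\alpha,\beta$. A BiHom-associative dialgebra is a tuple $(A,\dashv,\vdash,\alpha,\beta)$ consisting of a vector space $A$, bilinear maps $\dashv,\vdash:A\times A\to A$ and linear maps $\alpha,\beta:A\to A$ such that $\alpha\circ\beta=\beta\circ\alpha$ and, for all $x,y,z\in A$: (i) $(x\dashv y)\dashv\beta(z)=\alpha(x)\dashv(y\dashv z)$; (ii) $(x\dashv y)\dashv\beta(z)=\alpha(x)\dashv(y\vdash z)$; (iii) $(x\vdash y)\dashv\beta(z)=\alpha(x)\vdash(y\dashv z)$; (iv) $(x\dashv y)\vdash\beta(z)=\alpha(x)\vdash(y\vdash z)$; (v) $(x\vdash y)\vdash\beta(z)=\alpha(x)\vdash(y\vdash z)$. It is regular if $\alpha,\beta$ are bijective and preserve both products. An action of $D$ on $L$ consists of four bilinear maps, $\dashv,\vdash:D\times L\to L$ and $\dashv,\vdash:L\times D\to L$, such that the identities (i)-(v) above hold with $(x,y,z)$ replaced by any triple in which each entry is in $D$ or $L$ and both $D$ and $L$ occur, i.e. any triple in $D\times L\times L$, $L\times D\times L$, $L\times L\times D$, $L\times D\times D$, $D\times L\times D$ or $D\times D\times L$ (thirty identities in total). $L\rtimes D$ denotes the vector space $L\oplus D$ with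 products $(a,x)\triangleleft(b,y)=(a\dashv b+a\dashv y+x\dashv b,\ x\dashv y)$ and $(a,x)\triangleright(b,y)=(a\vdash b+a\vdash y+x\vdash b,\ x\vdash y)$ and structure maps $\alpha(a,x)=(\alpha(a),\alpha(x))$, $\beta(a,x)=(\beta(a),\beta(x))$. For an object $E$ with two products $\dashv,\vdash$ and bijective structure maps $\alpha,\beta$, $\mathbf{Lb}(E)$ denotes the space $E$ with the same structure maps and the bracket $[u,v]=u\dashv v-\alpha^{-1}\beta(v)\vdash\alpha\beta^{-1}(u)$ (for $E=L\rtimes D$, use $\triangleleft$ for $\dashv$ and $\triangleright$ for $\vdash$). The action of $D$ on $L$ induces mixed brackets of $\mathbf{Lb}(D)$ on $\mathbf{Lb}(L)$ with values in $L$: $[x,a]=x\dashv a-\alpha^{-1}\beta(a)\vdash\alpha\beta^{-1}(x)$ and $[a,x]=a\dashv x-\alpha^{-1}\beta(x)\vdash\alpha\beta^{-1}(a)$ for $x\in D$, $a\in L$. $\mathbf{Lb}(L)\rtimes\mathbf{Lb}(D)$ denotes the vector space $L\oplus D$ with bracket $[(a,x),(b,y)]=([a,b]+[x,b]+[a,y],\ [x,y])$ and the componentwise structure maps. *)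

theory Defs
  imports Complex_Main "HOL-Library.Product_Plus"
begin

text \<open>
  A vector space over a field \<open>'k\<close> is a type of class \<open>ab_group_add\<close> with a scalar multiplication
  satisfying the locale predicate \<open>vector_space\<close>; the direct sum \<open>L \<oplus> D\<close> is the product
  type \<open>'l \<times> 'd\<close>. The two products are allowed to be heterogeneous, so that the same notion serves
  both for the products of an algebra and for the mixed products of an action.
\<close>

record ('x, 'y, 'z) products =
  dashv :: "'x \<Rightarrow> 'y \<Rightarrow> 'z" (infixl \<open>\<stileturn>\<index>\<close> 70)
  vdash :: "'x \<Rightarrow> 'y \<Rightarrow> 'z" (infixl \<open>\<turnstile>\<index>\<close> 70)

record ('k, 'a) bihom_space =
  scal :: "'k \<Rightarrow> 'a \<Rightarrow> 'a"
  \<alpha> :: "'a \<Rightarrow> 'a"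
  \<beta> :: "'a \<Rightarrow> 'a"

record ('k, 'a) dialgebra = "('k, 'a) bihom_space" +
  prods :: "('a, 'a, 'a) products"

record ('k, 'a) bracket_algebra = "('k, 'a) bihom_space" +
  bracket :: "'a \<Rightarrow> 'a \<Rightarrow> 'a"

definition bilinear_map ::
  "('k::field \<Rightarrow> 'x::ab_group_add \<Rightarrow> 'x) \<Rightarrow> ('k \<Rightarrow> 'y::ab_group_add \<Rightarrow> 'y) \<Rightarrow>
   ('k \<Rightarrow> 'z::ab_group_add \<Rightarrow> 'z) \<Rightarrow> ('x \<Rightarrow> 'y \<Rightarrow> 'z) \<Rightarrow> bool" where
  "bilinear_map sx sy sz f \<longleftrightarrow>
     (\<forall>x. Vector_Spaces.linear sy sz (\<lambda>y. f x y)) \<and>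
     (\<forall>y. Vector_Spaces.linear sx sz (\<lambda>x. f x y))"

definition bilinear_products ::
  "('k::field \<Rightarrow> 'x::ab_group_add \<Rightarrow> 'x) \<Rightarrow> ('k \<Rightarrow> 'y::ab_group_add \<Rightarrow> 'y) \<Rightarrow>
   ('k \<Rightarrow> 'z::ab_group_add \<Rightarrow> 'z) \<Rightarrow> ('x, 'y, 'z) products \<Rightarrow> bool" where
  "bilinear_products sx sy sz P \<longleftrightarrow>
     bilinear_map sx sy sz (dashv P) \<and> bilinear_map sx sy sz (vdash P)"

text \<open>
  The five identities for triples in \<open>X \<times> Y \<times> Z\<close>. Here \<open>a\<close> is the map \<open>\<alpha>\<close> of \<open>X\<close> and \<open>b\<close> the map
  \<open>\<beta>\<close> of \<open>Z\<close>; \<open>xy\<close> and \<open>yz\<close> are the products \<open>X \<times> Y \<rightarrow> P\<close> and \<open>Y \<times> Z \<rightarrow> Q\<close>, while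
  \<open>pz\<close> and \<open>xq\<close> are the products \<open>P \<times> Z \<rightarrow> W\<close> and \<open>X \<times> Q \<rightarrow> W\<close>.
\<close>

definition dialgebra_identities ::
  "('x \<Rightarrow> 'x) \<Rightarrow> ('z \<Rightarrow> 'z) \<Rightarrow> ('x, 'y, 'p) products \<Rightarrow> ('y, 'z, 'q) products \<Rightarrow>
   ('p, 'z, 'w) products \<Rightarrow> ('x, 'q, 'w) products \<Rightarrow> bool" where
  "dialgebra_identities a b xy yz pz xq \<longleftrightarrow> (\<forall>x y z.
     (x \<stileturn>\<^bsub>xy\<^esub> y) \<stileturn>\<^bsub>pz\<^esub> b z = a x \<stileturn>\<^bsub>xq\<^esub> (y \<stileturn>\<^bsub>yz\<^esub> z) \<and>
     (x \<stileturn>\<^bsub>xy\<^esub> y) \<stileturn>\<^bsub>pz\<^esub> b z = a x \<stileturn>\<^bsub>xq\<^esub> (y \<turnstile>\<^bsub>yz\<^esub> z) \<and>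
     (x \<turnstile>\<^bsub>xy\<^esub> y) \<stileturn>\<^bsub>pz\<^esub> b z = a x \<turnstile>\<^bsub>xq\<^esub> (y \<stileturn>\<^bsub>yz\<^esub> z) \<and>
     (x \<stileturn>\<^bsub>xy\<^esub> y) \<turnstile>\<^bsub>pz\<^esub> b z = a x \<turnstile>\<^bsub>xq\<^esub> (y \<turnstile>\<^bsub>yz\<^esub> z) \<and>
     (x \<turnstile>\<^bsub>xy\<^esub> y) \<turnstile>\<^bsub>pz\<^esub> b z = a x \<turnstile>\<^bsub>xq\<^esub> (y \<turnstile>\<^bsub>yz\<^esub> z))"

definition bihom_assoc_dialgebra :: "('k::field, 'a::ab_group_add) dialgebra \<Rightarrow> bool" where
  "bihom_assoc_dialgebra A \<longleftrightarrow>
     vector_space (scal A) \<and>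
     Vector_Spaces.linear (scal A) (scal A) (\<alpha> A) \<and>
     Vector_Spaces.linear (scal A) (scal A) (\<beta> A) \<and>
     bilinear_products (scal A) (scal A) (scal A) (prods A) \<and>
     \<alpha> A \<circ> \<beta> A = \<beta> A \<circ> \<alpha> A \<and>
     dialgebra_identities (\<alpha> A) (\<beta> A) (prods A) (prods A) (prods A) (prods A)"

definition preserves_products :: "('a, 'a, 'a) products \<Rightarrow> ('a \<Rightarrow> 'a) \<Rightarrow> bool" where
  "preserves_products P f \<longleftrightarrow>
     (\<forall>x y. f (x \<stileturn>\<^bsub>P\<^esub> y) = f x \<stileturn>\<^bsub>P\<^esub> f y \<and> f (x \<turnstile>\<^bsub>P\<^esub> y) = f x \<turnstile>\<^bsub>P\<^esub> f y)"

definition regular_bihom_assoc_dialgebra ::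
  "('k::field, 'a::ab_group_add) dialgebra \<Rightarrow> bool" where
  "regular_bihom_assoc_dialgebra A \<longleftrightarrow>
     bihom_assoc_dialgebra A \<and> bij (\<alpha> A) \<and> bij (\<beta> A) \<and>
     preserves_products (prods A) (\<alpha> A) \<and> preserves_products (prods A) (\<beta> A)"

text \<open>
  \<open>dl\<close> and \<open>ld\<close> are the products \<open>D \<times> L \<rightarrow> L\<close> and \<open>L \<times> D \<rightarrow> L\<close>. The six lines of identities
  are for triples in \<open>D \<times> L \<times> L\<close>, \<open>L \<times> D \<times> L\<close>, \<open>L \<times> L \<times> D\<close>, \<open>L \<times> D \<times> D\<close>, \<open>D \<times> L \<times> D\<close> and
  \<open>D \<times> D \<times> L\<close>.
\<close>

definition dialgebra_action ::
  "('k::field, 'd::ab_group_add) dialgebra \<Rightarrow> ('k, 'l::ab_group_add) dialgebra \<Rightarrow>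
   ('d, 'l, 'l) products \<Rightarrow> ('l, 'd, 'l) products \<Rightarrow> bool" where
  "dialgebra_action D L dl ld \<longleftrightarrow>
     bilinear_products (scal D) (scal L) (scal L) dl \<and>
     bilinear_products (scal L) (scal D) (scal L) ld \<and>
     dialgebra_identities (\<alpha> D) (\<beta> L) dl (prods L) (prods L) dl \<and>
     dialgebra_identities (\<alpha> L) (\<beta> L) ld dl (prods L) (prods L) \<and>
     dialgebra_identities (\<alpha> L) (\<beta> D) (prods L) ld ld (prods L) \<and>
     dialgebra_identities (\<alpha> L) (\<beta> D) ld (prods D) ld ld \<and>
     dialgebra_identities (\<alpha> D) (\<beta> D) dl ld ld dl \<and>
     dialgebra_identities (\<alpha> D) (\<beta> L) (prods D) dl dl dl"

definition semidirect_dialgebra ::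
  "('k, 'l::ab_group_add) dialgebra \<Rightarrow> ('k, 'd::ab_group_add) dialgebra \<Rightarrow>
   ('d, 'l, 'l) products \<Rightarrow> ('l, 'd, 'l) products \<Rightarrow> ('k, 'l \<times> 'd) dialgebra" where
  "semidirect_dialgebra L D dl ld =
     \<lparr>scal = (\<lambda>c (a, x). (scal L c a, scal D c x)),
      \<alpha> = (\<lambda>(a, x). (\<alpha> L a, \<alpha> D x)),
      \<beta> = (\<lambda>(a, x). (\<beta> L a, \<beta> D x)),
      prods =
        \<lparr>dashv = (\<lambda>(a, x) (b, y).
           (a \<stileturn>\<^bsub>prods L\<^esub> b + a \<stileturn>\<^bsub>ld\<^esub> y + x \<stileturn>\<^bsub>dl\<^esub> b, x \<stileturn>\<^bsub>prods D\<^esub> y)),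
         vdash = (\<lambda>(a, x) (b, y).
           (a \<turnstile>\<^bsub>prods L\<^esub> b + a \<turnstile>\<^bsub>ld\<^esub> y + x \<turnstile>\<^bsub>dl\<^esub> b, x \<turnstile>\<^bsub>prods D\<^esub> y))\<rparr>\<rparr>"

text \<open>
  The brackets below use \<open>inv\<close>, which is the inverse map only for bijective structure maps.
\<close>

definition Lb :: "('k, 'a::ab_group_add) dialgebra \<Rightarrow> ('k, 'a) bracket_algebra" where
  "Lb E =
     \<lparr>scal = scal E, \<alpha> = \<alpha> E, \<beta> = \<beta> E,
      bracket = (\<lambda>u v. u \<stileturn>\<^bsub>prods E\<^esub> v
        - inv (\<alpha> E) (\<beta> E v) \<turnstile>\<^bsub>prods E\<^esub> \<alpha> E (inv (\<beta> E) u))\<rparr>"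

text \<open>
  The mixed product of an element of \<open>X\<close> and one of \<open>Y\<close>, with values in \<open>L\<close>, where \<open>{X, Y} = {D, L}\<close>;
  \<open>xy\<close> and \<open>yx\<close> are the action products \<open>X \<times> Y \<rightarrow> L\<close> and \<open>Y \<times> X \<rightarrow> L\<close>.
\<close>

definition mixed_bracket ::
  "('k, 'x) dialgebra \<Rightarrow> ('k, 'y) dialgebra \<Rightarrow> ('x, 'y, 'l::ab_group_add) products \<Rightarrow>
   ('y, 'x, 'l) products \<Rightarrow> 'x \<Rightarrow> 'y \<Rightarrow> 'l" where
  "mixed_bracket X Y xy yx u v =
     u \<stileturn>\<^bsub>xy\<^esub> v - inv (\<alpha> Y) (\<beta> Y v) \<turnstile>\<^bsub>yx\<^esub> \<alpha> X (inv (\<beta> X) u)"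

definition semidirect_bracket_algebra ::
  "('k, 'l::ab_group_add) bracket_algebra \<Rightarrow> ('k, 'd::ab_group_add) bracket_algebra \<Rightarrow>
   ('d \<Rightarrow> 'l \<Rightarrow> 'l) \<Rightarrow> ('l \<Rightarrow> 'd \<Rightarrow> 'l) \<Rightarrow> ('k, 'l \<times> 'd) bracket_algebra" where
  "semidirect_bracket_algebra M N br_dl br_ld =
     \<lparr>scal = (\<lambda>c (a, x). (scal M c a, scal N c x)),
      \<alpha> = (\<lambda>(a, x). (\<alpha> M a, \<alpha> N x)),
      \<beta> = (\<lambda>(a, x). (\<beta> M a, \<beta> N x)),
      bracket = (\<lambda>(a, x) (b, y).
        (bracket M a b + br_dl x b + br_ld a y, bracket N x y))\<rparr>"

end

theory Submission
  imports Defs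
begin

text \<open>
  Since the structure maps of \<open>L \<rtimes> D\<close> act componentwise and are bijective on each summand, their
  inverses act componentwise as well (lemma \<open>inv_componentwise\<close>). Write \<open>c'\<close> for \<open>\<alpha>\<^sup>-\<^sup>1 \<beta> c\<close> and
  \<open>c''\<close> for \<open>\<alpha> \<beta>\<^sup>-\<^sup>1 c\<close>. The first component of the bracket of \<open>(a, x)\<close> and \<open>(b, y)\<close> in
  \<open>Lb (L \<rtimes> D)\<close> is then the difference of \<open>a \<stileturn> b + a \<stileturn> y + x \<stileturn> b\<close> and
  \<open>b' \<turnstile> a'' + b' \<turnstile> x'' + y' \<turnstile> a''\<close>. Pairing the terms of the two sums gives
  \<open>[a, b] + [x, b] + [a, y]\<close>: the term \<open>b' \<turnstile> x''\<close>, with left factor in \<open>L\<close>, belongs to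
  \<open>[x, b]\<close>, and \<open>y' \<turnstile> a''\<close> belongs to \<open>[a, y]\<close>. The second component is \<open>[x, y]\<close>.
\<close>

lemma inv_componentwise:
  assumes "bij f" "bij g"
  shows "inv (\<lambda>(a, x). (f a, g x)) = (\<lambda>(a, x). (inv f a, inv g x))"
  by (rule inv_equality)
    (use assms in \<open>auto simp: bij_is_inj bij_is_surj surj_f_inv_f\<close>)

theorem theorem2p51:
  fixes D :: "('k::field, 'd::ab_group_add) dialgebra"
    and L :: "('k, 'l::ab_group_add) dialgebra"
    and dl :: "('d, 'l, 'l) products"
    and ld :: "('l, 'd, 'l) products"
  assumes "regular_bihom_assoc_dialgebra D"
    and "regular_bihom_assoc_dialgebra L"
    and "dialgebra_action D L dl ld"
  shows "Lb (semidirect_dialgebra L D dl ld) =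
    semidirect_bracket_algebra (Lb L) (Lb D)
      (mixed_bracket D L dl ld) (mixed_bracket L D ld dl)"
proof -
  have bij: "bij (\<alpha> L)" "bij (\<beta> L)" "bij (\<alpha> D)" "bij (\<beta> D)"
    using assms(1,2) by (auto simp: regular_bihom_assoc_dialgebra_def)
  show ?thesis
    by (simp add: Lb_def semidirect_dialgebra_def semidirect_bracket_algebra_def
        mixed_bracket_def inv_componentwise bij fun_eq_iff algebra_simps)
qed

end
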